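(* A domain $D\subseteq\{0,1\}^n$ admits a $k$-ary StrongDem aggregator (for some $k\ge2$) if and only if it admits a ternary aggregator $F=(f_1,\ldots,f_n)$ such that $f_j\in\{\wedge^{(3)},\vee^{(3)},{\rm maj}\}$ for $j=1,\ldots,n$.
   Context: Standing assumption: domains are non-degenerate (projection onto each coordinate is $\{0,1\}$). A $k$-ary aggregator for $D$ is an $n$-tuple $(f_1,\ldots,f_n)$ of unanimous functions $f_j:\{0,1\}^k\to\{0,1\}$ such that whenever $x^1,\ldots,x^k\in D$, $(f_1(x^1_1,\ldots,x^k_1),\ldots,f_n(x^1_n,\ldots,x^k_n))\in D$. It is StrongDem if for every $j$ and every $i\in\{1,\ldots,k\}$ there exist $a_1,\ldots,a_{i-1},a_{i+1},\ldots,a_k\in\{0,1\}$ with $f_j(a_1,\ldots,a_{i-1},0,a_{i+1},\ldots,a_k)=f_j(a_1,\ldots,a_{i-1},1,a_{i+1},\ldots,a_k)$. The ternary operations are $\wedge^{(3)}(x,y,z)=x\wedge y\wedge z$, $\vee^{(3)}(x,y,z)=x\vee y\vee z$, and ${\rm maj}(x,y,z)=1$ iff at least two of $x,y,z$ equal 1. *)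

theory Defs
  imports Main
begin

text \<open>
  The coordinates \<open>1, \<dots>, n\<close> are the elements of a finite type \<open>'n\<close>, and \<open>False\<close>, \<open>True\<close> stand
  for \<open>0\<close>, \<open>1\<close>; so \<open>{0,1}\<^sup>n\<close> is the type \<open>'n \<Rightarrow> bool\<close>.

  The arity \<open>k\<close> is a number, and \<open>{0,1}\<^sup>k\<close> consists of the lists of length \<open>k\<close>. A \<open>k\<close>-ary function
  is a function on \<open>bool list\<close> of which only the values on lists of length \<open>k\<close> are ever used.
  Positions \<open>1, \<dots>, k\<close> are the list indices \<open>0, \<dots>, k - 1\<close>.
\<close>

definition non_degenerate :: "('n \<Rightarrow> bool) set \<Rightarrow> bool" where
  "non_degenerate D \<longleftrightarrow> (\<forall>j. (\<lambda>x. x j) ` D = {False, True})"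

definition unanimous :: "nat \<Rightarrow> (bool list \<Rightarrow> bool) \<Rightarrow> bool" where
  "unanimous k f \<longleftrightarrow> (\<forall>a. f (replicate k a) = a)"

definition aggregator ::
  "nat \<Rightarrow> ('n \<Rightarrow> bool) set \<Rightarrow> ('n \<Rightarrow> bool list \<Rightarrow> bool) \<Rightarrow> bool" where
  "aggregator k D F \<longleftrightarrow>
     (\<forall>j. unanimous k (F j)) \<and>
     (\<forall>xs. length xs = k \<and> set xs \<subseteq> D \<longrightarrow> (\<lambda>j. F j (map (\<lambda>x. x j) xs)) \<in> D)"

text \<open>
  The entry \<open>a ! i\<close> of the witness is overwritten on both sides, so \<open>a\<close> supplies exactly the
  values at the other \<open>k - 1\<close> positions.
\<close>

definition StrongDem :: "nat \<Rightarrow> ('n \<Rightarrow> bool list \<Rightarrow> bool) \<Rightarrow> bool" where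
  "StrongDem k F \<longleftrightarrow>
     (\<forall>j. \<forall>i<k. \<exists>a. length a = k \<and> F j (a[i := False]) = F j (a[i := True]))"

fun and3 :: "bool list \<Rightarrow> bool" where
  "and3 [x, y, z] = (x \<and> y \<and> z)"

fun or3 :: "bool list \<Rightarrow> bool" where
  "or3 [x, y, z] = (x \<or> y \<or> z)"

fun maj :: "bool list \<Rightarrow> bool" where
  "maj [x, y, z] = (x \<and> y \<or> y \<and> z \<or> x \<and> z)"

end

theory Submission
  imports Defs
begin

text \<open>
  Ternary aggregators are closed under composition, carried out in all coordinates at once, so it
  suffices to construct suitable terms. A ternary unanimous function that is neither a projection
  nor the minority function \<open>x + y + z\<close> generates conjunction, disjunction or majority. If every
  ternary identification minor of \<open>f\<^sub>j\<close> is a projection or the minority function, then \<open>f\<^sub>j\<close> is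
  additive on \<open>{0,1}\<^sup>k\<close>, so some position is always pivotal, contrary to \<open>StrongDem\<close>. Hence every
  single coordinate can be made good. Finally, given \<open>T\<close> good on a set \<open>A\<close> of coordinates and \<open>S\<close>
  good at \<open>j\<close>, one of finitely many terms in \<open>T\<close> and \<open>S\<close> agrees with \<open>T\<close> on \<open>A\<close> and is good at \<open>j\<close>.
\<close>

section \<open>Ternary Boolean operations and terms in them\<close>

type_synonym ternary = "bool \<Rightarrow> bool \<Rightarrow> bool \<Rightarrow> bool"

definition idem :: "ternary \<Rightarrow> bool" where
  "idem t \<longleftrightarrow> (\<forall>a. t a a a = a)"

definition good :: "ternary \<Rightarrow> bool" where
  "good t \<longleftrightarrow>
     t = (\<lambda>x y z. x \<and> y \<and> z) \<or> t = (\<lambda>x y z. x \<or> y \<or> z) \<or>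
     t = (\<lambda>x y z. x \<and> y \<or> y \<and> z \<or> x \<and> z)"

definition proj_or_minority :: "ternary \<Rightarrow> bool" where
  "proj_or_minority t \<longleftrightarrow>
     t = (\<lambda>x y z. x) \<or> t = (\<lambda>x y z. y) \<or> t = (\<lambda>x y z. z) \<or> t = (\<lambda>x y z. (x = y) = z)"

definition rot :: "ternary \<Rightarrow> ternary" where
  "rot t = (\<lambda>x y z. t y z x)"

definition comp3 :: "ternary \<Rightarrow> ternary \<Rightarrow> ternary \<Rightarrow> ternary \<Rightarrow> ternary" where
  "comp3 s t u v = (\<lambda>x y z. s (t x y z) (u x y z) (v x y z))"

definition cyclic :: "ternary \<Rightarrow> ternary \<Rightarrow> ternary" where
  "cyclic s t = comp3 s t (rot t) (rot (rot t))"

definition absorb :: "ternary \<Rightarrow> ternary \<Rightarrow> ternary" where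
  "absorb t s = (\<lambda>x y z. t y z (t z x (t x y (s x y z))))"

definition nest :: "ternary \<Rightarrow> ternary" where
  "nest t = (\<lambda>x y z. t x y (t x y z))"

text \<open>With \<open>p x y = t x x y\<close> this is \<open>p (p x y) z\<close>, so a minor
  \<open>p\<close> that is a conjunction or disjunction becomes its ternary version.\<close>

definition fold2 :: "ternary \<Rightarrow> ternary" where
  "fold2 t = (\<lambda>x y z. t (t x x y) (t x x y) z)"

lemmas term_defs = rot_def comp3_def cyclic_def absorb_def nest_def fold2_def

text \<open>A symmetric idempotent operation is determined by its values at one and at two true
  arguments; of the four possibilities, monotonicity excludes only minority.\<close>

lemma good_iff:
  "good t \<longleftrightarrow>
    \<not> t False False False \<and> t True True True \<and>
    t False False True = t False True False \<and> t False True False = t True False False \<and>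
    t False True True = t True False True \<and> t True False True = t True True False \<and>
    (t False False True \<longrightarrow> t False True True)"
  unfolding good_def fun_eq_iff all_bool_eq by (simp, argo)

text \<open>
  If some two-variable minor of \<open>t\<close> is a conjunction or a disjunction, a term with \<open>fold2\<close> is good;
  otherwise \<open>nest\<close> of a rotation of \<open>t\<close> is majority.
\<close>

lemma good_term_single:
  assumes "idem t" "\<not> proj_or_minority t"
  shows "\<exists>u \<in> {t, rot t, rot (rot t)}. good (nest u) \<or> good (cyclic u (fold2 u))"
proof -
  \<comment> \<open>Idempotence fixes two of the eight values, which leaves 64 truth tables to
    check.\<close>
  have "(good (nest t) \<or> good (cyclic t (fold2 t))) \<or>
    (good (nest (rot t)) \<or> good (cyclic (rot t) (fold2 (rot t)))) \<or>
    (good (nest (rot (rot t))) \<or> good (cyclic (rot (rot t)) (fold2 (rot (rot t)))))"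
    using assms
    by (cases "t False False True"; cases "t False True False"; cases "t True False False";
        cases "t True True False"; cases "t True False True"; cases "t False True True";
        simp add: good_iff idem_def proj_or_minority_def term_defs fun_eq_iff all_bool_eq)
  then show ?thesis by simp
qed

text \<open>
  The point of \<open>absorb\<close>: for the minority function \<open>t\<close>, it is
  \<open>(y + z) + (z + x) + (x + y) + s = s\<close>, whereas it returns \<open>t\<close> if \<open>t\<close> is good.
\<close>

lemma good_term_exists:
  assumes "idem t" "good s"
  shows "good (cyclic s t) \<or> good (absorb t s) \<or>
    (\<exists>u \<in> {t, rot t, rot (rot t)}. good (nest u) \<or> good (cyclic u (fold2 u)))"
proof (cases "proj_or_minority t")
  case True
  \<comment> \<open>If \<open>t\<close> is a projection, \<open>cyclic s t\<close> merely permutes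
    the arguments of the symmetric \<open>s\<close>; minority is the case for
    \<open>absorb\<close>.\<close>
  then have "good (cyclic s t) \<or> good (absorb t s)"
    using assms(2) unfolding proj_or_minority_def good_def[of s]
    by (elim disjE) (simp_all add: good_iff term_defs)
  then show ?thesis by blast
qed (use good_term_single[OF assms(1)] in blast)

lemma good_induct [consumes 1]:
  assumes "good t" "P (\<lambda>x y z. x \<and> y \<and> z)" "P (\<lambda>x y z. x \<or> y \<or> z)"
    "P (\<lambda>x y z. x \<and> y \<or> y \<and> z \<or> x \<and> z)"
  shows "P t"
  using assms unfolding good_def by blast

text \<open>Symmetry makes the rotations of \<open>t\<close> coincide, so \<open>cyclic s t\<close>
  feeds the idempotent \<open>s\<close> three equal arguments. These identities protect the
  coordinates already treated while another one is repaired.\<close>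

lemma good_preserved:
  shows "good t \<Longrightarrow> idem s \<Longrightarrow> cyclic s t = t" "good t \<Longrightarrow> idem s \<Longrightarrow> absorb t s = t"
    "good t \<Longrightarrow> rot t = t" "good t \<Longrightarrow> nest t = t" "good t \<Longrightarrow> cyclic t (fold2 t) = t"
  by (erule good_induct; simp add: term_defs idem_def fun_eq_iff all_bool_eq)+

section \<open>Ternary aggregators, repaired coordinate by coordinate\<close>

definition ternary_aggregator :: "('n \<Rightarrow> bool) set \<Rightarrow> ('n \<Rightarrow> ternary) \<Rightarrow> bool" where
  "ternary_aggregator D T \<longleftrightarrow>
     (\<forall>j. idem (T j)) \<and> (\<forall>x\<in>D. \<forall>y\<in>D. \<forall>z\<in>D. (\<lambda>j. T j (x j) (y j) (z j)) \<in> D)"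

lemma ternary_aggregator_comp3:
  assumes "ternary_aggregator D S" "ternary_aggregator D T" "ternary_aggregator D U"
    "ternary_aggregator D V"
  shows "ternary_aggregator D (\<lambda>j. comp3 (S j) (T j) (U j) (V j))"
  using assms unfolding ternary_aggregator_def idem_def comp3_def by simp

lemma ternary_aggregator_proj: "ternary_aggregator D (\<lambda>j x y z. x)"
  by (simp add: ternary_aggregator_def idem_def)

lemma ternary_aggregator_rot:
  "ternary_aggregator D T \<Longrightarrow> ternary_aggregator D (\<lambda>j. rot (T j))"
  by (simp add: ternary_aggregator_def idem_def rot_def)

lemma ternary_aggregator_cyclic:
  "\<lbrakk>ternary_aggregator D S; ternary_aggregator D T\<rbrakk> \<Longrightarrow>
    ternary_aggregator D (\<lambda>j. cyclic (S j) (T j))"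
  unfolding cyclic_def by (intro ternary_aggregator_comp3 ternary_aggregator_rot)

lemma ternary_aggregator_absorb:
  "\<lbrakk>ternary_aggregator D T; ternary_aggregator D S\<rbrakk> \<Longrightarrow>
    ternary_aggregator D (\<lambda>j. absorb (T j) (S j))"
  by (simp add: ternary_aggregator_def idem_def absorb_def)

lemma ternary_aggregator_nest:
  "ternary_aggregator D T \<Longrightarrow> ternary_aggregator D (\<lambda>j. nest (T j))"
  by (simp add: ternary_aggregator_def idem_def nest_def)

lemma ternary_aggregator_fold2:
  "ternary_aggregator D T \<Longrightarrow> ternary_aggregator D (\<lambda>j. fold2 (T j))"
  by (simp add: ternary_aggregator_def idem_def fold2_def)

lemma ternary_aggregator_good_at:
  assumes T: "ternary_aggregator D T" and "\<not> proj_or_minority (T j)"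
  shows "\<exists>S. ternary_aggregator D S \<and> good (S j)"
proof -
  have "idem (T j)" using T by (simp add: ternary_aggregator_def)
  then obtain u where "u \<in> {T j, rot (T j), rot (rot (T j))}"
    and u: "good (nest u) \<or> good (cyclic u (fold2 u))"
    using good_term_single assms(2) by blast
  then obtain U where U: "ternary_aggregator D U" "U j = u"
    using T ternary_aggregator_rot[OF T] ternary_aggregator_rot[OF ternary_aggregator_rot[OF T]]
    by blast
  show ?thesis
    using u ternary_aggregator_nest[OF U(1)]
      ternary_aggregator_cyclic[OF U(1) ternary_aggregator_fold2[OF U(1)]]
    unfolding U(2)[symmetric] by blast
qed

lemma ternary_aggregator_extend:
  assumes T: "ternary_aggregator D T" and S: "ternary_aggregator D S"
    and A: "\<forall>i\<in>A. good (T i)" and j: "good (S j)"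
  shows "\<exists>U. ternary_aggregator D U \<and> (\<forall>i\<in>insert j A. good (U i))"
proof -
  have idem: "idem (T i)" "idem (S i)" for i
    using T S by (simp_all add: ternary_aggregator_def)
  have extend: ?thesis
    if "ternary_aggregator D U" "good (U j)" "\<forall>i\<in>A. U i = T i" for U
    using that A by auto
  consider "good (cyclic (S j) (T j))" | "good (absorb (T j) (S j))"
    | u where "u \<in> {T j, rot (T j), rot (rot (T j))}" "good (nest u) \<or> good (cyclic u (fold2 u))"
    using good_term_exists[OF idem(1) j] by blast
  then show ?thesis
  proof cases
    case 1
    show ?thesis
      by (rule extend[OF ternary_aggregator_cyclic[OF S T] 1])
        (use A idem good_preserved in blast)
  next
    case 2
    show ?thesis
      by (rule extend[OF ternary_aggregator_absorb[OF T S] 2])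
        (use A idem good_preserved in blast)
  next
    case 3
    \<comment> \<open>The rotation that works at \<open>j\<close> has to be taken in all coordinates
      at once; on \<open>A\<close> it changes nothing.\<close>
    have rot: "rot (T i) = T i" if "i \<in> A" for i using that A good_preserved(3) by blast
    obtain U where U: "ternary_aggregator D U" "U j = u" "\<And>i. i \<in> A \<Longrightarrow> U i = T i"
    proof -
      from 3(1) consider "u = T j" | "u = rot (T j)" | "u = rot (rot (T j))" by blast
      then show thesis
      proof cases
        case 1
        then show thesis using that[of T] T by simp
      next
        case 2
        then show thesis using that[of "\<lambda>i. rot (T i)"] ternary_aggregator_rot[OF T] rot by simp
      next
        case 3
        then show thesis
          using that[of "\<lambda>i. rot (rot (T i))"] rot
            ternary_aggregator_rot[OF ternary_aggregator_rot[OF T]] by simp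
      qed
    qed
    from 3(2) show ?thesis
    proof
      assume *: "good (nest u)"
      show ?thesis
        by (rule extend[OF ternary_aggregator_nest[OF U(1)]])
          (use * U A good_preserved in auto)
    next
      assume *: "good (cyclic u (fold2 u))"
      show ?thesis
        by (rule extend[OF ternary_aggregator_cyclic[OF U(1) ternary_aggregator_fold2[OF U(1)]]])
          (use * U A good_preserved in auto)
    qed
  qed
qed

lemma ternary_aggregator_good:
  fixes D :: "('n::finite \<Rightarrow> bool) set"
  assumes "\<And>j. \<exists>S. ternary_aggregator D S \<and> good (S j)"
  shows "\<exists>T. ternary_aggregator D T \<and> (\<forall>j. good (T j))"
proof -
  have "\<exists>T. ternary_aggregator D T \<and> (\<forall>j\<in>A. good (T j))" if "finite A" for A
    using that
  proof induction
    case empty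
    then show ?case using ternary_aggregator_proj by blast
  next
    case (insert j A)
    then obtain T S where "ternary_aggregator D T" "\<forall>i\<in>A. good (T i)"
      "ternary_aggregator D S" "good (S j)"
      using assms[of j] by blast
    then show ?case by (intro ternary_aggregator_extend)
  qed
  from this[of UNIV] show ?thesis by simp
qed

section \<open>Identification minors of a \<open>k\<close>-ary aggregator\<close>

text \<open>Identifying variables amounts to evaluating \<open>F\<close> on a list whose entries are
  all among three members of \<open>D\<close>.\<close>

lemma ternary_aggregator_minor:
  assumes "aggregator k D F"
  shows "ternary_aggregator D
    (\<lambda>j x y z. F j (map (\<lambda>l. if l \<in> P then x else if l \<in> Q then y else z) [0..<k]))"
  unfolding ternary_aggregator_def
proof (intro conjI allI ballI)
  fix j
  show "idem (\<lambda>x y z. F j (map (\<lambda>l. if l \<in> P then x else if l \<in> Q then y else z) [0..<k]))"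
    using assms by (simp add: aggregator_def unanimous_def idem_def map_replicate_const)
next
  fix x y z assume "x \<in> D" "y \<in> D" "z \<in> D"
  let ?xs = "map (\<lambda>l. if l \<in> P then x else if l \<in> Q then y else z) [0..<k]"
  have "length ?xs = k" "set ?xs \<subseteq> D" using \<open>x \<in> D\<close> \<open>y \<in> D\<close> \<open>z \<in> D\<close> by auto
  then have "(\<lambda>j. F j (map (\<lambda>v. v j) ?xs)) \<in> D"
    using assms unfolding aggregator_def by blast
  moreover have "map (\<lambda>v. v j) ?xs =
      map (\<lambda>l. if l \<in> P then x j else if l \<in> Q then y j else z j) [0..<k]" for j
    by simp
  ultimately show
    "(\<lambda>j. F j (map (\<lambda>l. if l \<in> P then x j else if l \<in> Q then y j else z j) [0..<k])) \<in> D"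
    by (simp only:)
qed

lemma StrongDem_good_at:
  assumes F: "aggregator k D F" and SD: "StrongDem k F"
  shows "\<exists>S. ternary_aggregator D S \<and> good (S j)"
proof (rule ccontr)
  assume contra: "\<nexists>S. ternary_aggregator D S \<and> good (S j)"
  \<comment> \<open>\<open>h\<close> is \<open>F j\<close> read as a function of the set of true
    positions.\<close>
  define h where "h P = F j (map (\<lambda>l. l \<in> P) [0..<k])" for P
  have additive: "h (P \<union> Q) \<longleftrightarrow> h P \<noteq> h Q" if "P \<inter> Q = {}" for P Q
  proof -
    define t where
      "t x y z = F j (map (\<lambda>l. if l \<in> P then x else if l \<in> Q then y else z) [0..<k])" for x y z
    have "proj_or_minority t"
      using ternary_aggregator_good_at[OF ternary_aggregator_minor[OF F, of P Q]] contra
      unfolding t_def by blast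
    \<comment> \<open>Projections and minority are sums modulo 2 of some of their arguments.\<close>
    then have "t True True False \<longleftrightarrow> t True False False \<noteq> t False True False"
      by (auto simp: proj_or_minority_def)
    moreover have "t True True False = h (P \<union> Q)" "t True False False = h P"
      "t False True False = h Q"
      unfolding t_def h_def using that
      by (auto intro!: arg_cong[where f = "F j"])
    ultimately show ?thesis by simp
  qed
  have "h {0..<k}"
  proof -
    have "map (\<lambda>l. l \<in> {0..<k}) [0..<k] = replicate k True"
      by (rule nth_equalityI) auto
    then show ?thesis
      using F unfolding h_def aggregator_def unanimous_def by simp
  qed
  have "\<exists>i<k. h {i}"
  proof (rule ccontr)
    assume no: "\<not> (\<exists>i<k. h {i})"
    \<comment> \<open>Positions are added one at a time; the start is \<open>h {}\<close>, false
      because additivity gives \<open>h {} = (h {} \<noteq> h {})\<close>.\<close>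
    have "\<not> h {0..<m}" if "m \<le> k" for m
      using that
    proof (induction m)
      case 0
      then show ?case using additive[of "{}" "{}"] by simp
    next
      case (Suc m)
      then show ?case
        using additive[of "{0..<m}" "{m}"] no by (simp add: atLeastLessThanSuc)
    qed
    with \<open>h {0..<k}\<close> show False by blast
  qed
  then obtain i where i: "i < k" "h {i}" by blast
  obtain a where a: "length a = k" "F j (a[i := False]) = F j (a[i := True])"
    using SD i(1) unfolding StrongDem_def by blast
  \<comment> \<open>Flipping position \<open>i\<close> of the witness passes from \<open>P\<close>
    to \<open>P \<union> {i}\<close>, and by additivity \<open>h {i}\<close> makes the two values
    differ.\<close>
  define P where "P = {l. l < k \<and> l \<noteq> i \<and> a ! l}"
  have "a[i := False] = map (\<lambda>l. l \<in> P) [0..<k]"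
    by (rule nth_equalityI) (auto simp: P_def a(1) i(1) nth_list_update)
  moreover have "a[i := True] = map (\<lambda>l. l \<in> P \<union> {i}) [0..<k]"
    by (rule nth_equalityI) (auto simp: P_def a(1) i(1) nth_list_update)
  ultimately have "h P = h (P \<union> {i})" using a(2) by (simp add: h_def)
  with additive[of P "{i}"] i(2) show False by (auto simp: P_def)
qed

section \<open>Back to operations on lists\<close>

lemma good_imp_list_operation:
  assumes "good t"
  shows "\<exists>f\<in>{and3, or3, maj}. \<forall>x y z. f [x, y, z] = t x y z"
  using assms by (auto simp: good_def)

lemma ternary_aggregator_imp_aggregator:
  assumes T: "ternary_aggregator D T" and F: "\<And>j x y z. F j [x, y, z] = T j x y z"
  shows "aggregator 3 D F"
  unfolding aggregator_def
proof (intro conjI allI impI)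
  fix j
  show "unanimous 3 (F j)"
    using T by (simp add: unanimous_def F ternary_aggregator_def idem_def numeral_3_eq_3)
next
  fix xs :: "('a \<Rightarrow> bool) list"
  assume "length xs = 3 \<and> set xs \<subseteq> D"
  then obtain x y z where "xs = [x, y, z]" "x \<in> D" "y \<in> D" "z \<in> D"
    by (auto simp: numeral_3_eq_3 length_Suc_conv)
  then show "(\<lambda>j. F j (map (\<lambda>x. x j) xs)) \<in> D"
    using T by (simp add: F ternary_aggregator_def)
qed

lemma StrongDem_and3_or3_maj:
  assumes "\<And>j. F j \<in> {and3, or3, maj}"
  shows "StrongDem 3 F"
  unfolding StrongDem_def
proof (intro allI impI)
  fix j and i :: nat assume "i < 3"
  then have i: "i = 0 \<or> i = Suc 0 \<or> i = Suc (Suc 0)" by auto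
  \<comment> \<open>Two arguments \<open>True\<close> decide \<open>or3\<close>, and two arguments
    \<open>False\<close> decide \<open>and3\<close> and \<open>maj\<close>, whatever the third
    is.\<close>
  define b where "b \<longleftrightarrow> F j = or3"
  have "F j ([b, b, b][i := False]) = F j ([b, b, b][i := True])"
  proof (cases b)
    case True
    then show ?thesis using i unfolding b_def by auto
  next
    case False
    then have "F j = and3 \<or> F j = maj" using assms[of j] by (auto simp: b_def)
    then show ?thesis using i False by auto
  qed
  then show "\<exists>a. length a = 3 \<and> F j (a[i := False]) = F j (a[i := True])"
    by (intro exI[of _ "[b, b, b]"]) simp
qed

theorem theorem5p21:
  fixes D :: "('n::finite \<Rightarrow> bool) set"
  assumes "non_degenerate D"
  shows "(\<exists>k\<ge>2. \<exists>F. aggregator k D F \<and> StrongDem k F) \<longleftrightarrow>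
         (\<exists>F. aggregator 3 D F \<and> (\<forall>j. F j \<in> {and3, or3, maj}))"
proof
  assume "\<exists>k\<ge>2. \<exists>F. aggregator k D F \<and> StrongDem k F"
  then obtain T where T: "ternary_aggregator D T" "\<And>j. good (T j)"
    using ternary_aggregator_good StrongDem_good_at by metis
  obtain F where F: "\<And>j. F j \<in> {and3, or3, maj}" "\<And>j x y z. F j [x, y, z] = T j x y z"
    using good_imp_list_operation[OF T(2)] by metis
  then show "\<exists>F. aggregator 3 D F \<and> (\<forall>j. F j \<in> {and3, or3, maj})"
    using ternary_aggregator_imp_aggregator[OF T(1)] by blast
next
  assume "\<exists>F. aggregator 3 D F \<and> (\<forall>j. F j \<in> {and3, or3, maj})"
  then obtain F where "aggregator 3 D F" "StrongDem 3 F"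
    using StrongDem_and3_or3_maj by blast
  then show "\<exists>k\<ge>2. \<exists>F. aggregator k D F \<and> StrongDem k F"
    by (intro exI[of _ 3]) auto
qed

end
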